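(* Let $(V,\top)$ be a strongly separating locality vector space of countable dimension, i.e. $V$ is a vector space of countable dimension over a field $\mathbb{K}$ and $\top$ is a vector space locality relation on $V$ such that the induced relation $\top_{V,G}$ on the lattice $G(V)$ of linear subspaces of $V$ is a strongly separating locality relation. Then $V$ has a locality basis for $\top$, that is, there is a basis $\{e_\alpha\}_{\alpha\in\Gamma}$ of $V$ such that $e_\alpha\,\top\, e_\beta$ whenever $\alpha\neq\beta$.
   Context: For a symmetric binary relation $\top$ on a set $X$ and $A\subseteq X$, the polar set is $A^\top:=\{x'\in X\mid x\,\top\, x'\text{ for all }x\in A\}$; $a^\top:=\{a\}^\top$ for $a\in X$. A vector space locality relation on $V$ is a symmetric binary relation $\top$ on $V$ such that $X^\top$ is a linear subspace of $V$ for every subset $X\subseteq V$. $G(V)$ is the set of linear subspaces of $V$ ordered by inclusion, a bounded lattice with join $+$, meet $\cap$, least element $\{0\}$, greatest element $V$. The relation $\top_{V,G}$ on $G(V)$ is defined by $U\,\top_{V,G}\,W\iff u\,\top\,w$ for all $u\in U$, $w\in W$. For a bounded lattice $(L,\leq,0,1)$: a poset ideal is a subset $M$ with $a\in M$, $b\leq a\Rightarrow b\in M$; a lattice ideal is a poset ideal closed under $\vee$. A locality relation on $L$ is a symmetric binary relation $\top$ on $L$ such that $a^\top$ is a lattice ideal for every $a\in L$. It is strongly separating if (a) $a\,\top\,b\Rightarrow a\wedge b=0$; (b) each $a^\top$ has a greatest element $\operatorname{grt}(a^\top)$; (c) $\operatorname{grt}((a^\top)^\top)=a$ for all $a\in L$.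 *)

theory Defs
  imports Complex_Main "HOL-Library.Countable_Set" "HOL-Algebra.Lattice"
begin

definition polar :: "'a set \<Rightarrow> ('a \<Rightarrow> 'a \<Rightarrow> bool) \<Rightarrow> 'a set \<Rightarrow> 'a set"
  where "polar X T A = {x' \<in> X. \<forall>x\<in>A. T x x'}"


section \<open>Locality relations on bounded lattices\<close>

text \<open>Ideals are not required to be nonempty.\<close>

definition poset_ideal :: "('a, 'b) gorder_scheme \<Rightarrow> 'a set \<Rightarrow> bool"
  where "poset_ideal L M \<longleftrightarrow>
    M \<subseteq> carrier L \<and> (\<forall>a\<in>M. \<forall>b\<in>carrier L. b \<sqsubseteq>\<^bsub>L\<^esub> a \<longrightarrow> b \<in> M)"

definition lattice_ideal :: "('a, 'b) gorder_scheme \<Rightarrow> 'a set \<Rightarrow> bool"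
  where "lattice_ideal L M \<longleftrightarrow>
    poset_ideal L M \<and> (\<forall>a\<in>M. \<forall>b\<in>M. a \<squnion>\<^bsub>L\<^esub> b \<in> M)"

locale lattice_locality = bounded_lattice L for L (structure) +
  fixes T :: "'a \<Rightarrow> 'a \<Rightarrow> bool"
  assumes locality_sym: "symp_on (carrier L) T"
    and lattice_ideal_polar: "a \<in> carrier L \<Longrightarrow> lattice_ideal L (polar (carrier L) T {a})"

text \<open>
  In the last assumption, \<^term>\<open>greatest L a A\<close> says that \<open>A\<close> has a greatest element and
  that this element is \<open>a\<close>.
\<close>

locale strongly_separating_lattice_locality = lattice_locality +
  assumes meet_eq_bottom:
      "\<lbrakk>a \<in> carrier L; b \<in> carrier L; T a b\<rbrakk> \<Longrightarrow> a \<sqinter> b = \<bottom>"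
    and polar_has_greatest:
      "a \<in> carrier L \<Longrightarrow> \<exists>g. greatest L g (polar (carrier L) T {a})"
    and greatest_bipolar:
      "a \<in> carrier L \<Longrightarrow> greatest L a (polar (carrier L) T (polar (carrier L) T {a}))"


section \<open>Locality vector spaces\<close>

text \<open>The underlying vector space is the whole type, with scalar multiplication \<open>scale\<close>.\<close>

locale locality_vector_space = vector_space scale
  for scale :: "'k::field \<Rightarrow> 'v::ab_group_add \<Rightarrow> 'v" +
  fixes T :: "'v \<Rightarrow> 'v \<Rightarrow> bool"
  assumes locality_sym: "symp T"
    and subspace_polar: "subspace (polar UNIV T X)"

definition subspace_lattice :: "('k::field \<Rightarrow> 'v::ab_group_add \<Rightarrow> 'v) \<Rightarrow> 'v set gorder"
  where "subspace_lattice scale =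
    \<lparr>carrier = {U. module.subspace scale U}, eq = (=), le = (\<subseteq>)\<rparr>"

definition subspace_locality :: "('v \<Rightarrow> 'v \<Rightarrow> bool) \<Rightarrow> 'v set \<Rightarrow> 'v set \<Rightarrow> bool"
  where "subspace_locality T U W \<longleftrightarrow> (\<forall>u\<in>U. \<forall>w\<in>W. T u w)"

locale strongly_separating_locality_vector_space =
  locality_vector_space scale T +
  G: strongly_separating_lattice_locality "subspace_lattice scale" "subspace_locality T"
  for scale :: "'k::field \<Rightarrow> 'v::ab_group_add \<Rightarrow> 'v" and T

text \<open>A basis is a set of vectors, that is, a family indexed by itself.\<close>

definition vs_basis :: "('k::field \<Rightarrow> 'v::ab_group_add \<Rightarrow> 'v) \<Rightarrow> 'v set \<Rightarrow> bool"
  where "vs_basis scale B \<longleftrightarrow> \<not> module.dependent scale B \<and> module.span scale B = UNIV"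

definition locality_basis ::
    "('k::field \<Rightarrow> 'v::ab_group_add \<Rightarrow> 'v) \<Rightarrow> ('v \<Rightarrow> 'v \<Rightarrow> bool) \<Rightarrow> 'v set \<Rightarrow> bool"
  where "locality_basis scale T B \<longleftrightarrow> vs_basis scale B \<and> pairwise T B"


section \<open>The lattice structure of the set of subspaces\<close>

context vector_space
begin

lemma subspace_lattice_simps [simp]:
  "carrier (subspace_lattice scale) = {U. subspace U}"
  "eq (subspace_lattice scale) = (=)"
  "le (subspace_lattice scale) = (\<subseteq>)"
  by (simp_all add: subspace_lattice_def)

lemma is_lub_sum:
  assumes "subspace U" "subspace W"
  shows "least (subspace_lattice scale) {x + y |x y. x \<in> U \<and> y \<in> W}
    (Upper (subspace_lattice scale) {U, W})"
proof -
  have "U \<subseteq> {x + y |x y. x \<in> U \<and> y \<in> W}"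
  proof
    fix x assume "x \<in> U"
    then show "x \<in> {x + y |x y. x \<in> U \<and> y \<in> W}"
      using subspace_0[OF assms(2)] by (intro CollectI exI[of _ x] exI[of _ 0]) auto
  qed
  moreover have "W \<subseteq> {x + y |x y. x \<in> U \<and> y \<in> W}"
  proof
    fix x assume "x \<in> W"
    then show "x \<in> {x + y |x y. x \<in> U \<and> y \<in> W}"
      using subspace_0[OF assms(1)] by (intro CollectI exI[of _ 0] exI[of _ x]) auto
  qed
  ultimately show ?thesis
    using assms subspace_sums[OF assms] by (auto simp: least_def Upper_def intro!: subspace_add)
qed

lemma is_glb_inter:
  assumes "subspace U" "subspace W"
  shows "greatest (subspace_lattice scale) (U \<inter> W) (Lower (subspace_lattice scale) {U, W})"
  using assms subspace_inter[OF assms] by (auto simp: greatest_def Lower_def)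

lemma is_least_zero:
  "least (subspace_lattice scale) {0} (carrier (subspace_lattice scale))"
  by (auto simp: least_def subspace_0)

lemma is_greatest_UNIV:
  "greatest (subspace_lattice scale) UNIV (carrier (subspace_lattice scale))"
  by (auto simp: greatest_def)

lemma bounded_lattice_subspaces: "bounded_lattice (subspace_lattice scale)"
proof unfold_locales
  fix U W
  assume "U \<in> carrier (subspace_lattice scale)" "W \<in> carrier (subspace_lattice scale)"
  then have "subspace U" "subspace W" by simp_all
  then show "\<exists>s. least (subspace_lattice scale) s (Upper (subspace_lattice scale) {U, W})"
    and "\<exists>s. greatest (subspace_lattice scale) s (Lower (subspace_lattice scale) {U, W})"
    using is_lub_sum is_glb_inter by blast+
next
  show "\<exists>x. least (subspace_lattice scale) x (carrier (subspace_lattice scale))"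
    using is_least_zero by blast
  show "\<exists>x. greatest (subspace_lattice scale) x (carrier (subspace_lattice scale))"
    using is_greatest_UNIV by blast
qed auto

lemma subspace_lattice_join:
  assumes "subspace U" "subspace W"
  shows "U \<squnion>\<^bsub>subspace_lattice scale\<^esub> W = {x + y |x y. x \<in> U \<and> y \<in> W}"
proof -
  interpret G: bounded_lattice "subspace_lattice scale" by (rule bounded_lattice_subspaces)
  show ?thesis
    unfolding join_def sup_def
    by (rule some_equality, rule is_lub_sum[OF assms])
      (rule G.least_unique[OF _ is_lub_sum[OF assms]])
qed

lemma subspace_lattice_meet:
  assumes "subspace U" "subspace W"
  shows "U \<sqinter>\<^bsub>subspace_lattice scale\<^esub> W = U \<inter> W"
proof -
  interpret G: bounded_lattice "subspace_lattice scale" by (rule bounded_lattice_subspaces)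
  show ?thesis
    unfolding meet_def inf_def
    by (rule some_equality, rule is_glb_inter[OF assms])
      (rule G.greatest_unique[OF _ is_glb_inter[OF assms]])
qed

lemma subspace_lattice_bottom: "\<bottom>\<^bsub>subspace_lattice scale\<^esub> = {0}"
proof -
  interpret G: bounded_lattice "subspace_lattice scale" by (rule bounded_lattice_subspaces)
  show ?thesis using G.least_unique[OF G.bottom_least is_least_zero] .
qed

lemma subspace_lattice_top: "\<top>\<^bsub>subspace_lattice scale\<^esub> = UNIV"
proof -
  interpret G: bounded_lattice "subspace_lattice scale" by (rule bounded_lattice_subspaces)
  show ?thesis using G.greatest_unique[OF G.top_greatest is_greatest_UNIV] .
qed

end

end

theory Submission
  imports Defs
begin

text \<open>
  A locality basis is found as a maximal orthogonal set, where orthogonality of distinct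
  vectors means being related by \<open>T\<close>. Zorn's lemma provides a maximal set \<open>E\<close> of nonzero,
  pairwise orthogonal vectors.

  Condition (a) of strong separation makes \<open>T\<close> anisotropic: only the zero vector is related to
  itself (\<open>locality_self_imp_zero\<close>). Hence \<open>E\<close> is independent, because a vector of \<open>E\<close> in the
  span of the others would lie in its own polar (\<open>independent_if_pairwise_locality\<close>).

  By maximality and anisotropy, no nonzero vector is orthogonal to all of \<open>E\<close>. So the polar of
  \<open>span E\<close> is trivial and the bipolar is the whole space; but condition (c) says that the bipolar
  of a subspace is that subspace, so \<open>E\<close> spans (\<open>span_eq_UNIV_if_polar_trivial\<close>).
\<close>

lemma (in locality_vector_space) locality_symD: "T x y \<Longrightarrow> T y x"
  using locality_sym by (rule sympD)

lemma (in locality_vector_space) locality_zero_right: "T x 0"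
  using subspace_0[OF subspace_polar[of "{x}"]] by (simp add: polar_def)

lemma (in locality_vector_space) locality_span_right:
  assumes "\<And>y. y \<in> S \<Longrightarrow> T x y" and "z \<in> span S"
  shows "T x z"
proof -
  have "span S \<subseteq> polar UNIV T {x}"
    using assms(1) by (intro span_minimal subspace_polar) (auto simp: polar_def)
  with assms(2) show ?thesis by (auto simp: polar_def)
qed

context strongly_separating_locality_vector_space
begin

text \<open>
  A vector related to itself generates a line which is related to itself in the lattice of
  subspaces, so this line equals its own meet with itself, which is zero.
\<close>

lemma locality_self_imp_zero:
  assumes "T x x"
  shows "x = 0"
proof -
  have x_line: "T x z" if "z \<in> span {x}" for z
    using locality_span_right[of "{x}" x z] assms that by simp
  have "T y z" if "y \<in> span {x}" and "z \<in> span {x}" for y z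
    using locality_span_right[of "{x}" y z] locality_symD[OF x_line[OF that(1)]] that(2) by simp
  then have "subspace_locality T (span {x}) (span {x})"
    by (simp add: subspace_locality_def)
  then have "span {x} \<inter> span {x} = {0}"
    using G.meet_eq_bottom[of "span {x}" "span {x}"]
    by (simp add: subspace_lattice_meet subspace_lattice_bottom)
  then show ?thesis
    using span_base[of x "{x}"] by auto
qed

lemma independent_if_pairwise_locality:
  assumes "pairwise T E" and "0 \<notin> E"
  shows "independent E"
proof
  assume "dependent E"
  then obtain x where "x \<in> E" and "x \<in> span (E - {x})"
    by (auto simp: dependent_def)
  moreover from \<open>x \<in> E\<close> have "T x y" if "y \<in> E - {x}" for y
    using assms(1) that by (auto simp: pairwise_def)
  ultimately have "T x x"
    by (blast intro: locality_span_right)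
  with \<open>x \<in> E\<close> assms(2) show False
    using locality_self_imp_zero by auto
qed

text \<open>
  All subspaces are closed under taking bipolars, and the bipolar of a set with trivial polar
  contains every vector.
\<close>

lemma span_eq_UNIV_if_polar_trivial:
  assumes "polar UNIV T E \<subseteq> {0}"
  shows "span E = UNIV"
proof -
  let ?L = "subspace_lattice scale" and ?R = "subspace_locality T"
  have "U \<subseteq> {0}" if "U \<in> polar (carrier ?L) ?R {span E}" for U
    using that assms span_superset[of E]
    by (auto simp: polar_def subspace_locality_def)
  then have "UNIV \<in> polar (carrier ?L) ?R (polar (carrier ?L) ?R {span E})"
    using locality_symD[OF locality_zero_right]
    by (subst polar_def) (fastforce simp: subspace_locality_def)
  moreover have "greatest ?L (span E) (polar (carrier ?L) ?R (polar (carrier ?L) ?R {span E}))"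
    using G.greatest_bipolar[of "span E"] by simp
  ultimately show ?thesis
    by (auto simp: greatest_def)
qed

lemma polar_trivial_if_maximal_pairwise_locality:
  assumes "pairwise T E" and "0 \<notin> E"
    and maximal: "\<And>F. pairwise T F \<Longrightarrow> 0 \<notin> F \<Longrightarrow> E \<subseteq> F \<Longrightarrow> F = E"
  shows "polar UNIV T E \<subseteq> {0}"
proof
  fix x assume "x \<in> polar UNIV T E"
  then have orth: "T y x" if "y \<in> E" for y
    using that by (simp add: polar_def)
  show "x \<in> {0}"
  proof (rule ccontr)
    assume "x \<notin> {0}"
    moreover have "pairwise T (insert x E)"
      using assms(1) orth locality_symD by (auto simp: pairwise_insert)
    ultimately have "insert x E = E"
      using assms(2) by (intro maximal) auto
    with orth have "T x x" by auto
    with \<open>x \<notin> {0}\<close> show False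
      using locality_self_imp_zero by simp
  qed
qed

theorem ex_locality_basis: "\<exists>B. locality_basis scale T B"
proof -
  let ?A = "{E. pairwise T E \<and> 0 \<notin> E}"
  have "\<exists>E\<in>?A. \<forall>F\<in>?A. E \<subseteq> F \<longrightarrow> F = E"
  proof (rule subset_Zorn')
    fix C assume "subset.chain ?A C"
    then have "C \<subseteq> ?A" and "chain\<^sub>\<subseteq> C"
      by (auto simp: subset_chain_def chain_subset_def)
    then show "\<Union>C \<in> ?A"
      using pairwise_chain_Union[of C T] by auto
  qed
  then obtain E where E: "pairwise T E" "0 \<notin> E"
    and maximal: "\<And>F. pairwise T F \<Longrightarrow> 0 \<notin> F \<Longrightarrow> E \<subseteq> F \<Longrightarrow> F = E"
    by blast
  have "span E = UNIV"
    using E maximal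
    by (intro span_eq_UNIV_if_polar_trivial polar_trivial_if_maximal_pairwise_locality)
  with E show ?thesis
    using independent_if_pairwise_locality by (auto simp: locality_basis_def vs_basis_def)
qed

end

theorem proposition6p6:
  fixes scale :: "'k::field \<Rightarrow> 'v::ab_group_add \<Rightarrow> 'v"
    and T :: "'v \<Rightarrow> 'v \<Rightarrow> bool"
  assumes "strongly_separating_locality_vector_space scale T"
    and "\<exists>B. vs_basis scale B \<and> countable B"
  shows "\<exists>B. locality_basis scale T B"
  using assms(1) by (rule strongly_separating_locality_vector_space.ex_locality_basis)

end
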